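(* Let $J\subset(0,1)^{2}$ and $H\subset\mathbb{R}$ be compact. As $N\to\infty$, uniformly for integers $K,n$ with $(\kappa,\eta)=(K/N,n/N)\in J$ and for $t\in H$ with $\mu+t\in\mathbb{Z}$, one has the complete asymptotic expansion $$\log\Bigl[\sqrt{2\pi\Sigma_0^{2}}\;P(\mu+t)\Bigr]\sim\sum_{m\ge1}\frac{A_m(t)}{N^{m}},$$ with $$A_m(t)=\frac{(-1)^{m+1}}{m(m+1)}\Bigl[(W_m-1)\,B_{m+1}-\bigl(a^{-m}+d^{-m}\bigr)B_{m+1}(t+1)-\bigl(b^{-m}+c^{-m}\bigr)B_{m+1}(1-t)\Bigr],$$ where $W_m=\kappa^{-m}+(1-\kappa)^{-m}+\eta^{-m}+(1-\eta)^{-m}$.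
   Context: The hypergeometric law $\mathrm{Hyp}(N,K,n)$ has mass function $P(k)=\binom Kk\binom{N-K}{n-k}\big/\binom Nn$, with mean $\mu=nK/N$. Here $N,K,n$ are integers with $0<K<N$, $0<n<N$, and $\kappa=K/N$, $\eta=n/N$. Put $$a=\kappa\eta,\quad b=\kappa(1-\eta),\quad c=\eta(1-\kappa),\quad d=(1-\kappa)(1-\eta),$$ and $$\Sigma_0^{2}=\Bigl[\frac1{Na}+\frac1{Nb}+\frac1{Nc}+\frac1{Nd}\Bigr]^{-1}=N\,ad=\frac{nK(N-K)(N-n)}{N^{3}}.$$ $B_n(t)$ denotes the Bernoulli polynomials, $\sum_{n\ge0}B_n(t)z^n/n!=ze^{tz}/(e^z-1)$, and $B_n=B_n(0)$. Meaning of the expansion: for every fixed integer $M\ge0$, the difference between the left-hand side and $\sum_{m=1}^{M}A_m(t)N^{-m}$ is $O(N^{-M-1})$ as $N\to\infty$, with implied constant and threshold on $N$ depending only on $M$, $J$, $H$. *)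

theory Defs
  imports "HOL-Analysis.Analysis" "HOL-Computational_Algebra.Computational_Algebra"
begin

(* B_n(t) is n! times the n-th coefficient of z e^(tz) / (e^z - 1). The quotient is taken among
   formal power series; it is exact since e^z - 1 has subdegree 1, see bernpoly_genfun. *)
definition bernpoly :: "nat \<Rightarrow> real \<Rightarrow> real" where
  "bernpoly n t = fact n * fps_nth (fps_X * fps_exp t / (fps_exp 1 - 1)) n"

abbreviation bernoulli_number :: "nat \<Rightarrow> real" where
  "bernoulli_number n \<equiv> bernpoly n 0"

lemma bernpoly_genfun:
  "Abs_fps (\<lambda>n. bernpoly n t / fact n) * (fps_exp 1 - 1) = fps_X * fps_exp t"
proof -
  let ?g = "fps_exp 1 - 1 :: real fps"
  have g1: "fps_nth ?g 1 \<noteq> 0"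
    by simp
  have nz: "?g \<noteq> 0" using g1 by (metis fps_zero_nth)
  have "subdegree ?g \<le> 1"
    by (rule subdegree_leI) (rule g1)
  moreover have "subdegree (fps_X * fps_exp t) = 1"
    by simp
  ultimately have "?g dvd fps_X * fps_exp t"
    using fps_dvd_iff[OF nz, of "fps_X * fps_exp t"] by (metis subdegree_0 zero_neq_one)
  moreover have "Abs_fps (\<lambda>n. bernpoly n t / fact n) = fps_X * fps_exp t / ?g"
    by (rule fps_ext) (simp add: bernpoly_def)
  ultimately show ?thesis by simp
qed

(* The value at an integer k; the range condition is needed because n - nat k truncates. *)
definition hyp_mass :: "nat \<Rightarrow> nat \<Rightarrow> nat \<Rightarrow> int \<Rightarrow> real" where
  "hyp_mass N K n k =
     (if 0 \<le> k \<and> k \<le> int n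
      then real (K choose nat k) * real ((N - K) choose (n - nat k)) / real (N choose n)
      else 0)"

definition hyp_mean :: "nat \<Rightarrow> nat \<Rightarrow> nat \<Rightarrow> real" where
  "hyp_mean N K n = real n * real K / real N"

definition Sigma0_sq :: "nat \<Rightarrow> nat \<Rightarrow> nat \<Rightarrow> real" where
  "Sigma0_sq N K n =
     (let \<kappa> = real K / real N; \<eta> = real n / real N;
          a = \<kappa> * \<eta>; b = \<kappa> * (1 - \<eta>); c = \<eta> * (1 - \<kappa>); d = (1 - \<kappa>) * (1 - \<eta>)
      in inverse (1 / (real N * a) + 1 / (real N * b) + 1 / (real N * c) + 1 / (real N * d)))"

lemma Sigma0_sq_altdef:
  assumes "0 < K" "K < N" "0 < n" "n < N"
  shows "Sigma0_sq N K n =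
           real n * real K * (real N - real K) * (real N - real n) / real N ^ 3"
proof -
  define x y z where "x = real K" and "y = real n" and "z = real N"
  have pos: "x > 0" "y > 0" "z > 0" "z - x > 0" "z - y > 0"
    using assms by (auto simp: x_def y_def z_def)
  have e: "1 - x / z = (z - x) / z" "1 - y / z = (z - y) / z"
    using pos by (auto simp: field_simps)
  define u v where "u = z - x" and "v = z - y"
  have uv: "u > 0" "v > 0" "z = u + x" "y = u + x - v"
    using pos by (auto simp: u_def v_def)
  have "1 / (z * (x / z * (y / z))) + 1 / (z * (x / z * (v / z)))
      + 1 / (z * (y / z * (u / z))) + 1 / (z * (u / z * (v / z)))
      = z * (u * v + u * y + x * v + x * y) / (x * y * u * v)"
    using pos uv(1,2) by (simp add: divide_simps) (simp add: algebra_simps)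
  also have "u * v + u * y + x * v + x * y = z ^ 2"
    by (simp add: u_def v_def algebra_simps power2_eq_square)
  finally show ?thesis
    unfolding Sigma0_sq_def Let_def x_def[symmetric] y_def[symmetric] z_def[symmetric] e
      u_def[symmetric] v_def[symmetric]
    by (simp add: power2_eq_square power3_eq_cube mult_ac)
qed

definition hyp_coeff :: "real \<Rightarrow> real \<Rightarrow> nat \<Rightarrow> real \<Rightarrow> real" where
  "hyp_coeff \<kappa> \<eta> m t =
     (let a = \<kappa> * \<eta>; b = \<kappa> * (1 - \<eta>); c = \<eta> * (1 - \<kappa>); d = (1 - \<kappa>) * (1 - \<eta>);
          W = 1 / \<kappa> ^ m + 1 / (1 - \<kappa>) ^ m + 1 / \<eta> ^ m + 1 / (1 - \<eta>) ^ m
      in (-1) ^ (m + 1) / (real m * real (m + 1)) *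
           ((W - 1) * bernoulli_number (m + 1)
            - (1 / a ^ m + 1 / d ^ m) * bernpoly (m + 1) (t + 1)
            - (1 / b ^ m + 1 / c ^ m) * bernpoly (m + 1) (1 - t)))"

end

theory Submission
  imports Defs "HOL-Real_Asymp.Real_Asymp"
begin

text \<open>
  The mass \<^term>\<open>hyp_mass N K n k\<close> is a quotient of nine factorials: those of the four margins
  $K$, $N-K$, $n$, $N-n$ over those of the total $N$ and of the four cells
  $Na+t$, $Nb-t$, $Nc-t$, $Nd+t$ of a two-by-two table. Each factorial is $\Gamma(x+s)$ with $x$ a multiple of
  $N$ by a factor that is bounded away from $0$ on $J$, and with $s \in \{1, t+1, 1-t\}$ bounded on
  $H$. The theorem therefore follows by adding nine copies of the shifted Stirling expansion
  \[ \ln\Gamma(x+s) = (x+s-\tfrac12)\ln x - x + \tfrac12\ln 2\pi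
       + \sum_{m=1}^{M} \frac{(-1)^{m+1}B_{m+1}(s)}{m(m+1)\,x^m} + O(x^{-M-1}), \]
  uniformly for bounded $s$ (\<open>ln_Gamma_stirling_uniform\<close>). The leading terms add up to
  $-\frac12\ln(2\pi\Sigma_0^2)$ (\<open>hyp_main_terms_cancel\<close>), and the coefficients of $x^{-m}$ add up to
  $A_m(t) N^{-m}$ (\<open>hyp_coeff_conv_stirling_coeff\<close>).

  The Stirling expansion is proved from the difference equation of $\ln\Gamma$. Let $S_M(x,s)$ be the
  right-hand side without the error term. Then $S_M(x+1,s) - S_M(x,s) - \ln(x+s) = O(x^{-M-2})$
  (\<open>stirling_sum_increment\<close>): this expression is a power series in $1/x$, and its low coefficients
  vanish exactly by the recurrence $\sum_{j\le k}{k+1 \choose j}B_j(s) = (k+1)s^k$. Hence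
  $\ln\Gamma(x+s) - S_M(x,s)$ has increments of order $x^{-M-2}$ under $x \mapsto x+1$. It tends to $0$
  along $x, x+1, x+2, \dots$ by Stirling's formula for factorials (\<open>stirling_sum_limit\<close>), whose constant
  comes from Wallis' product. Summing the increments gives the bound $O(x^{-M-1})$.
\<close>

section \<open>Bernoulli polynomials\<close>

lemma fps_exp_1_minus_1_nonzero: "fps_exp 1 - 1 \<noteq> (0 :: real fps)"
proof
  assume "fps_exp 1 - 1 = (0 :: real fps)"
  then have "fps_nth (fps_exp 1 - 1 :: real fps) 1 = 0" by simp
  then show False by simp
qed

text \<open>
  Comparing coefficients of $z^{k+1}$ in $B(z)\,(e^z - 1) = z e^{sz}$. This recurrence is what
  makes the low coefficients in the increment of the Stirling expansion cancel.
\<close>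
lemma bernpoly_sum:
  "(\<Sum>j\<le>k. real (Suc k choose j) * bernpoly j s) = real (Suc k) * s ^ k"
proof -
  define F where "F = Abs_fps (\<lambda>n. bernpoly n s / fact n)"
  have "fps_nth (F * (fps_exp 1 - 1)) (Suc k) = (\<Sum>j\<le>Suc k. fps_nth F j * fps_nth (fps_exp 1 - 1) (Suc k - j))"
    by (simp add: fps_mult_nth atLeast0AtMost)
  also have "\<dots> = (\<Sum>j\<le>k. fps_nth F j * fps_nth (fps_exp 1 - 1) (Suc k - j))"
    by simp
  also have "\<dots> = (\<Sum>j\<le>k. real (Suc k choose j) * bernpoly j s) / fact (Suc k)"
    unfolding sum_divide_distrib
    by (intro sum.cong) (auto simp: F_def binomial_fact divide_simps simp del: fact_Suc)
  also have "F * (fps_exp 1 - 1) = fps_X * fps_exp s"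
    unfolding F_def by (rule bernpoly_genfun)
  finally have "fps_nth (fps_X * fps_exp s) (Suc k)
      = (\<Sum>j\<le>k. real (Suc k choose j) * bernpoly j s) / fact (Suc k)" .
  then have "(\<Sum>j\<le>k. real (Suc k choose j) * bernpoly j s) = fact (Suc k) * (s ^ k / fact k)"
    by (simp add: divide_simps mult_ac del: fact_Suc)
  also have "fact (Suc k) * (s ^ k / fact k) = real (Suc k) * s ^ k"
    by simp
  finally show ?thesis .
qed

text \<open>
  The factor $e^{sz}$ splits off the generating function, so \<^term>\<open>bernpoly n\<close> is a polynomial in
  its argument. Its continuity gives bounds that are uniform for arguments in a compact set.
\<close>
lemma bernpoly_conv_bernoulli_number:
  "bernpoly n s = (\<Sum>i\<le>n. real (n choose i) * bernoulli_number i * s ^ (n - i))"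
proof -
  define F where "F = Abs_fps (\<lambda>n. bernoulli_number n / fact n)"
  define G where "G = Abs_fps (\<lambda>n. bernpoly n s / fact n)"
  have "G * (fps_exp 1 - 1) = (F * fps_exp s) * (fps_exp 1 - 1)"
    using bernpoly_genfun[of s] bernpoly_genfun[of 0] unfolding F_def G_def
    by (simp add: mult_ac)
  then have "fps_nth G n = fps_nth (F * fps_exp s) n"
    by (simp add: fps_exp_1_minus_1_nonzero)
  also have "\<dots> = (\<Sum>i\<le>n. real (n choose i) * bernoulli_number i * s ^ (n - i)) / fact n"
    unfolding sum_divide_distrib fps_mult_nth atLeast0AtMost
    by (intro sum.cong) (auto simp: F_def binomial_fact divide_simps)
  finally show ?thesis by (simp add: G_def)
qed

lemma continuous_on_bernpoly: "continuous_on A (bernpoly n)"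
proof -
  have "continuous_on A (\<lambda>s. \<Sum>i\<le>n. real (n choose i) * bernoulli_number i * s ^ (n - i))"
    by (intro continuous_intros)
  then show ?thesis by (simp flip: bernpoly_conv_bernoulli_number)
qed

text \<open>
  The generating functions at $1$ and at $0$ differ by $z(e^z - 1)/(e^z - 1) = z$. At index $1$ the
  two values are $1/2$ and $-1/2$.
\<close>
lemma bernpoly_1_eq_bernoulli_number:
  assumes "n \<noteq> 1" shows "bernpoly n 1 = bernoulli_number n"
proof -
  define D where "D = Abs_fps (\<lambda>n. bernpoly n 1 / fact n) - Abs_fps (\<lambda>n. bernoulli_number n / fact n)"
  have "D * (fps_exp 1 - 1) = fps_X * (fps_exp 1 - 1)"
    unfolding D_def left_diff_distrib bernpoly_genfun by (simp add: algebra_simps)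
  then have "D = fps_X" by (simp add: fps_exp_1_minus_1_nonzero)
  then have "fps_nth D n = 0" using assms by simp
  then show ?thesis by (simp add: D_def)
qed

lemma bernpoly_0: "bernpoly 0 s = 1"
  using bernpoly_sum[of 0 s] by simp

lemma bernpoly_1: "bernpoly 1 s = s - 1/2"
  using bernpoly_sum[of 1 s] by (simp add: bernpoly_0)

section \<open>Coefficients of the Stirling expansion\<close>

text \<open>
  The coefficient of $x^{-m}$ in the expansion of \<^term>\<open>ln_Gamma (x + s)\<close>.
\<close>
definition stirling_coeff :: "nat \<Rightarrow> real \<Rightarrow> real" where
  "stirling_coeff m s = (-1) ^ (m + 1) * bernpoly (m + 1) s / (real m * real (m + 1))"

definition stirling_leading :: "real \<Rightarrow> real \<Rightarrow> real" where
  "stirling_leading x s = (x + s - 1/2) * ln x - x + ln (2 * pi) / 2"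

text \<open>
  The expansion is centred at \<^term>\<open>x\<close> rather than at \<^term>\<open>x + s\<close>: in the application \<^term>\<open>x\<close> is a
  fixed multiple of the population size while \<^term>\<open>s\<close> stays bounded.
\<close>
definition stirling_sum :: "nat \<Rightarrow> real \<Rightarrow> real \<Rightarrow> real" where
  "stirling_sum M x s = stirling_leading x s + (\<Sum>m=1..M. stirling_coeff m s / x ^ m)"

text \<open>
  The coefficients of $\ln(1+z)$. At index $0$ the convention $y/0 = 0$ gives the correct value $0$.
\<close>
definition ln1p_coeff :: "nat \<Rightarrow> real" where
  "ln1p_coeff k = - ((-1) ^ k) / real k"

text \<open>
  With $u = 1/x$, the left-hand side is the coefficient of $u^k$ in
  \<^term>\<open>stirling_sum M (x + 1) s - stirling_sum M x s - ln (x + s)\<close> for $k \le M + 1$. Writing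
  ${-m \choose k-m} = \pm{k-1 \choose m-1}$ and
  ${k-1 \choose m-1}/(m(m+1)) = {k+1 \choose m+1}/(k(k+1))$ turns the assertion into the recurrence of the
  Bernoulli polynomials.
\<close>
lemma stirling_coeff_recurrence:
  assumes "k \<ge> 1"
  shows "ln1p_coeff (Suc k) + (s + 1/2) * ln1p_coeff k - ln1p_coeff k * s ^ k
         + (\<Sum>m=1..<k. stirling_coeff m s * ((- real m) gchoose (k - m))) = 0"
proof -
  have eq: "stirling_coeff m s * ((- real m) gchoose (k - m))
      = - ((-1) ^ k * (real (Suc k choose Suc m) * bernpoly (Suc m) s) / (real k * real (Suc k)))"
    if m: "m \<in> {1..<k}" for m
  proof -
    have "(- real m) gchoose (k - m) = (-1) ^ (k - m) * (real (k - 1) gchoose (k - m))"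
      using m by (subst gbinomial_minus) (simp add: of_nat_diff algebra_simps)
    also have "real (k - 1) gchoose (k - m) = real ((k - 1) choose (k - m))"
      by (simp add: binomial_gbinomial)
    also have "(k - 1) choose (k - m) = (k - 1) choose (m - 1)"
      using m by (subst binomial_symmetric) (auto intro!: arg_cong2[of _ _ _ _ binomial])
    finally have g: "(- real m) gchoose (k - m) = (-1) ^ (k - m) * real ((k - 1) choose (m - 1))" .
    have "Suc m * m * (Suc k choose Suc m) = Suc k * (m * (k choose m))"
      using Suc_times_binomial[of m k] by (metis mult.assoc mult.commute)
    also have "m * (k choose m) = k * ((k - 1) choose (m - 1))"
      using m times_binomial_minus1_eq[of m k] by simp
    finally have "real (Suc m) * real m * real (Suc k choose Suc m)
        = real (Suc k) * real k * real ((k - 1) choose (m - 1))"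
      by (simp only: flip: of_nat_mult)
    then have "real ((k - 1) choose (m - 1)) / (real m * real (m + 1))
        = real (Suc k choose Suc m) / (real k * real (Suc k))"
      using m by (simp add: divide_simps mult_ac del: binomial_Suc_Suc)
    moreover have "(-1) ^ (m + 1) * (-1) ^ (k - m) = (- ((-1) ^ k) :: real)"
      using m by (simp flip: power_add)
    moreover have "stirling_coeff m s * ((- real m) gchoose (k - m))
       = ((-1) ^ (m + 1) * (-1) ^ (k - m)) * bernpoly (Suc m) s
          * (real ((k - 1) choose (m - 1)) / (real m * real (m + 1)))"
      by (simp add: g stirling_coeff_def)
    ultimately show ?thesis by simp
  qed
  \<comment> \<open>The terms with Bernoulli index 0 and 1 do not come from any coefficient; they account for the logarithms.\<close>
  have "real (Suc k) * s ^ k = (\<Sum>j\<le>k. real (Suc k choose j) * bernpoly j s)"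
    by (simp add: bernpoly_sum)
  also have "{..k} = insert 0 (insert 1 (Suc ` {1..<k}))"
  proof (intro equalityI subsetI)
    fix j assume "j \<in> {..k}"
    then show "j \<in> insert 0 (insert 1 (Suc ` {1..<k}))"
      by (cases j) (auto simp: image_iff)
  qed (use assms in auto)
  also have "(\<Sum>j\<in>\<dots>. real (Suc k choose j) * bernpoly j s)
     = 1 + real (Suc k) * (s - 1/2) + (\<Sum>m=1..<k. real (Suc k choose Suc m) * bernpoly (Suc m) s)"
  proof -
    have "(\<Sum>j\<in>Suc ` {1..<k}. real (Suc k choose j) * bernpoly j s)
        = (\<Sum>m=1..<k. real (Suc k choose Suc m) * bernpoly (Suc m) s)"
      by (subst sum.reindex) auto
    moreover have "0 \<notin> insert 1 (Suc ` {1..<k})" "1 \<notin> Suc ` {1..<k}"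
      by auto
    ultimately show ?thesis
      using bernpoly_1[of s] by (simp add: bernpoly_0 del: image_Suc_atLeastLessThan)
  qed
  finally have S: "(\<Sum>m=1..<k. real (Suc k choose Suc m) * bernpoly (Suc m) s)
     = real (Suc k) * s ^ k - 1 - real (Suc k) * (s - 1/2)" by simp
  have "(\<Sum>m=1..<k. stirling_coeff m s * ((- real m) gchoose (k - m)))
     = - ((-1) ^ k * (\<Sum>m=1..<k. real (Suc k choose Suc m) * bernpoly (Suc m) s) / (real k * real (Suc k)))"
    by (simp add: eq sum_negf sum_divide_distrib sum_distrib_left del: binomial_Suc_Suc)
  also have "\<dots> = - ((-1) ^ k * (real (Suc k) * s ^ k - 1 - real (Suc k) * (s - 1/2))) / (real k * real (Suc k))"
    by (simp only: S)
  finally have T: "(\<Sum>m=1..<k. stirling_coeff m s * ((- real m) gchoose (k - m)))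
     = - ((-1) ^ k * (real (Suc k) * s ^ k - 1 - real (Suc k) * (s - 1/2))) / (real k * real (Suc k))" .
  show ?thesis
    unfolding T ln1p_coeff_def using assms
    by (simp add: divide_simps) (simp add: algebra_simps)
qed

text \<open>
  The polynomial that remains of $u$ times the increment of \<^term>\<open>stirling_sum M\<close>, minus
  $u\ln(x+s)$, when each of the functions $\ln(1+u)$, $\ln(1+su)$ and $(1+u)^{-m}$ is replaced by its
  Taylor polynomial. The factor $u$ clears the denominator of $\ln(1+u)/u$, which is why the first
  Taylor polynomial of $\ln(1+u)$ has one term more than the second.
\<close>
lemma stirling_truncation_vanishes:
  "(\<Sum>k<M+3. ln1p_coeff k * u ^ k) + (s + 1/2) * u * (\<Sum>k<M+2. ln1p_coeff k * u ^ k) - u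
   - u * (\<Sum>k<M+2. ln1p_coeff k * (s * u) ^ k)
   + (\<Sum>m=1..M. stirling_coeff m s * u ^ (m + 1) *
        ((\<Sum>j<M+2-m. ((- real m) gchoose j) * u ^ j) - 1)) = 0"
proof -
  let ?g = "\<lambda>m k. stirling_coeff m s * ((- real m) gchoose (k - m)) * u ^ k"
  have inner: "u ^ (m + 1) * ((\<Sum>j<M+2-m. ((- real m) gchoose j) * u ^ j) - 1)
      = u * (\<Sum>k\<in>{m<..<M+2}. ((- real m) gchoose (k - m)) * u ^ k)" if m: "m \<in> {1..M}" for m
  proof -
    have "{..<M+2-m} = insert 0 {0<..<M+2-m}"
      using m by auto
    then have "(\<Sum>j<M+2-m. ((- real m) gchoose j) * u ^ j) - 1 = (\<Sum>j\<in>{0<..<M+2-m}. ((- real m) gchoose j) * u ^ j)"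
      by simp
    also have "u ^ m * \<dots> = (\<Sum>k\<in>{m<..<M+2}. ((- real m) gchoose (k - m)) * u ^ k)"
      unfolding sum_distrib_left
      by (rule sum.reindex_bij_witness[of _ "\<lambda>k. k - m" "\<lambda>j. j + m"]) (auto simp: power_add)
    finally show ?thesis
      by (simp add: mult.assoc)
  qed
  have "(\<Sum>m=1..M. stirling_coeff m s * u ^ (m + 1) *
        ((\<Sum>j<M+2-m. ((- real m) gchoose j) * u ^ j) - 1))
      = (\<Sum>m=1..M. u * (\<Sum>k\<in>{m<..<M+2}. ?g m k))"
    unfolding mult.assoc[of "stirling_coeff _ _"]
    by (intro sum.cong refl, simp only: inner) (simp add: sum_distrib_left mult_ac)
  also have "\<dots> = u * (\<Sum>m\<in>{1..M}. \<Sum>k | k \<in> {..<M+2} \<and> m < k. ?g m k)"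
    unfolding sum_distrib_left by (intro sum.cong) auto
  also have "(\<Sum>m\<in>{1..M}. \<Sum>k | k \<in> {..<M+2} \<and> m < k. ?g m k)
      = (\<Sum>k\<in>{..<M+2}. \<Sum>m | m \<in> {1..M} \<and> m < k. ?g m k)"
    by (rule sum.swap_restrict) auto
  also have "\<dots> = (\<Sum>k<M+2. \<Sum>m=1..<k. ?g m k)"
    by (intro sum.cong) auto
  finally have double: "(\<Sum>m=1..M. stirling_coeff m s * u ^ (m + 1) *
        ((\<Sum>j<M+2-m. ((- real m) gchoose j) * u ^ j) - 1)) = u * (\<Sum>k<M+2. \<Sum>m=1..<k. ?g m k)" .
  have shift: "(\<Sum>k<M+3. ln1p_coeff k * u ^ k) = u * (\<Sum>k<M+2. ln1p_coeff (Suc k) * u ^ k)"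
  proof -
    have "(\<Sum>k<M+3. ln1p_coeff k * u ^ k) = (\<Sum>k<Suc (M+2). ln1p_coeff k * u ^ k)"
      by (simp add: numeral_3_eq_3)
    also have "\<dots> = ln1p_coeff 0 * u ^ 0 + (\<Sum>k<M+2. ln1p_coeff (Suc k) * u ^ Suc k)"
      by (rule sum.lessThan_Suc_shift)
    also have "\<dots> = u * (\<Sum>k<M+2. ln1p_coeff (Suc k) * u ^ k)"
      unfolding sum_distrib_left by (simp add: ln1p_coeff_def mult_ac del: sum.lessThan_Suc)
    finally show ?thesis .
  qed
  \<comment> \<open>The coefficient of u^(k+1), apart from the isolated term -u; the latter cancels k = 0.\<close>
  define q where "q k = ln1p_coeff (Suc k) + (s + 1/2) * ln1p_coeff k - ln1p_coeff k * s ^ k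
       + (\<Sum>m=1..<k. stirling_coeff m s * ((- real m) gchoose (k - m)))" for k
  have q: "q k = (if k = 0 then 1 else 0)" for k
    using stirling_coeff_recurrence[of k s] by (auto simp: q_def ln1p_coeff_def)
  have "(\<Sum>k<M+2. q k * u ^ k) = 1"
    by (simp add: q if_distrib[of "\<lambda>x. x * _"] cong: if_cong)
  moreover have "(\<Sum>k<M+2. q k * u ^ k) = (\<Sum>k<M+2. ln1p_coeff (Suc k) * u ^ k)
      + (s + 1/2) * (\<Sum>k<M+2. ln1p_coeff k * u ^ k) - (\<Sum>k<M+2. ln1p_coeff k * (s * u) ^ k)
      + (\<Sum>k<M+2. \<Sum>m=1..<k. ?g m k)"
    unfolding q_def
    by (simp add: sum.distrib sum_subtractf sum_distrib_left sum_distrib_right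
          power_mult_distrib algebra_simps)
  ultimately have "u * 1 = u * ((\<Sum>k<M+2. ln1p_coeff (Suc k) * u ^ k)
      + (s + 1/2) * (\<Sum>k<M+2. ln1p_coeff k * u ^ k) - (\<Sum>k<M+2. ln1p_coeff k * (s * u) ^ k)
      + (\<Sum>k<M+2. \<Sum>m=1..<k. ?g m k))"
    by metis
  then show ?thesis
    unfolding double shift by (simp add: algebra_simps)
qed

section \<open>Taylor remainders\<close>

text \<open>
  The remainder is $z^n$ times a convergent power series, which is continuous and hence bounded near $0$.
\<close>
lemma power_series_remainder_bigo:
  fixes f :: "real \<Rightarrow> real"
  assumes r: "r > 0" and sums: "\<And>z. \<bar>z\<bar> < r \<Longrightarrow> (\<lambda>k. a k * z ^ k) sums f z"
  shows "(\<lambda>z. f z - (\<Sum>k<n. a k * z ^ k)) \<in> O[nhds 0](\<lambda>z. z ^ n)"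
proof -
  define h where "h z = (\<Sum>k. a (k + n) * z ^ k)" for z
  have summ: "summable (\<lambda>k. a (k + n) * (r / 2) ^ k)"
    using sums[of "r / 2"] r
    by (intro summable_powser_ignore_initial_segment[THEN iffD2]) (auto simp: sums_iff)
  have "isCont h 0"
    unfolding h_def by (rule isCont_powser[OF summ]) (use r in auto)
  then have "(h \<longlongrightarrow> h 0) (nhds 0)"
    by (simp add: continuous_at_imp_continuous_within isCont_def tendsto_at_iff_tendsto_nhds)
  then have "h \<in> O[nhds 0](\<lambda>_. 1)"
    by (intro bigoI_tendsto[of _ _ "h 0"]) auto
  then have "(\<lambda>z. z ^ n * h z) \<in> O[nhds 0](\<lambda>z. z ^ n * 1)"
    by (intro landau_o.big.mult) auto
  moreover have "eventually (\<lambda>z. z ^ n * h z = f z - (\<Sum>k<n. a k * z ^ k)) (nhds 0)"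
  proof -
    have "eventually (\<lambda>z::real. z \<in> {-r<..<r}) (nhds 0)"
      using r by (intro eventually_nhds_in_open) auto
    then show ?thesis
    proof eventually_elim
      case (elim z)
      have "(\<lambda>k. a (k + n) * z ^ (k + n)) sums (f z - (\<Sum>k<n. a k * z ^ k))"
        using sums_split_initial_segment[OF sums[of z], of n] elim by auto
      then have "(\<Sum>k. z ^ n * (a (k + n) * z ^ k)) = f z - (\<Sum>k<n. a k * z ^ k)"
        by (simp add: sums_iff power_add mult_ac)
      moreover have "summable (\<lambda>k. a (k + n) * z ^ k)"
        using sums[of z] elim
        by (intro summable_powser_ignore_initial_segment[THEN iffD2]) (auto simp: sums_iff)
      ultimately show ?case
        by (simp add: h_def suminf_mult)
    qed
  qed
  ultimately show ?thesis
    by (simp add: landau_o.big.in_cong)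
qed

lemma ln1p_remainder_bigo:
  "(\<lambda>z. ln (1 + z) - (\<Sum>k<n. ln1p_coeff k * z ^ k)) \<in> O[nhds 0](\<lambda>z. z ^ n)"
proof (rule power_series_remainder_bigo[of 1])
  show "(\<lambda>k. ln1p_coeff k * z ^ k) sums ln (1 + z)" if "\<bar>z\<bar> < 1" for z
    using ln_series'[OF that] by (simp add: ln1p_coeff_def power_minus[of z])
qed simp

lemma inverse_power_remainder_bigo:
  "(\<lambda>z. 1 / (1 + z) ^ m - (\<Sum>j<n. ((- real m) gchoose j) * z ^ j)) \<in> O[nhds 0](\<lambda>z. z ^ n)"
proof (rule power_series_remainder_bigo[of 1])
  show "(\<lambda>j. ((- real m) gchoose j) * z ^ j) sums (1 / (1 + z) ^ m)" if "\<bar>z\<bar> < 1" for z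
    using gen_binomial_real[OF that, of "- real m"] that
    by (simp add: powr_minus powr_realpow field_simps)
qed simp

section \<open>The increment of the Stirling expansion\<close>

text \<open>
  Uniformity for a parameter in a set \<^term>\<open>A\<close> is expressed by Landau symbols for the product with
  the principal filter of \<^term>\<open>A\<close>; in this calculus a continuous function of a parameter in a compact
  set acts as a constant.
\<close>
lemma bigo_one_of_continuous_snd:
  fixes f :: "real \<Rightarrow> real"
  assumes "continuous_on A f" "compact A"
  shows "(\<lambda>p. f (snd p)) \<in> O[F \<times>\<^sub>F principal A](\<lambda>_. 1)"
proof -
  obtain B where B: "\<And>s. s \<in> A \<Longrightarrow> \<bar>f s\<bar> \<le> B"
    using compact_imp_bounded[OF compact_continuous_image[OF assms]]
    by (auto simp: bounded_iff)
  have "eventually (\<lambda>p. True \<and> snd p \<in> A) (F \<times>\<^sub>F principal A)"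
    by (rule eventually_prodI) (auto simp: eventually_principal)
  then show ?thesis
    by (intro bigoI[of _ B]) (auto elim!: eventually_mono intro: B)
qed

text \<open>
  In the variable $u = 1/x$ the expression is a finite combination, with coefficients bounded in
  \<^term>\<open>s\<close>, of $\ln(1+u)/u$, $\ln(1+u)$, $\ln(1+su)$ and powers of $u/(1+u)$. The Taylor polynomials of these
  functions cancel, so only their remainders are left, and each of them has order $u^{M+2}$.
\<close>
lemma stirling_sum_increment:
  "\<exists>C X0. \<forall>x\<ge>X0. \<forall>s. \<bar>s\<bar> \<le> R \<longrightarrow>
     \<bar>stirling_sum M (x + 1) s - stirling_sum M x s - ln (x + s)\<bar> \<le> C / x ^ (M + 2)"
proof -
  define F where "F = (at_top :: real filter) \<times>\<^sub>F principal {-R..R}"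
  define u :: "real \<times> real \<Rightarrow> real" where "u p = 1 / fst p" for p
  define A where "A n z = ln (1 + z) - (\<Sum>k<n. ln1p_coeff k * z ^ k)" for n and z :: real
  define G where "G m z = 1 / (1 + z) ^ m - (\<Sum>j<M+2-m. ((- real m) gchoose j) * z ^ j)" for m and z :: real
  define D where "D x s = stirling_sum M (x + 1) s - stirling_sum M x s - ln (x + s)" for x s
  \<comment> \<open>The Taylor remainders collected, multiplied by u.\<close>
  define err where "err p = A (M + 3) (u p) + (snd p + 1/2) * (u p * A (M + 2) (u p))
      - u p * A (M + 2) (snd p * u p)
      + (\<Sum>m=1..M. stirling_coeff m (snd p) * (u p ^ (m + 1) * G m (u p)))" for p
  have fst_F: "filterlim fst at_top F"
    unfolding F_def by (rule filterlim_fst)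
  have u_lim: "filterlim u (nhds 0) F"
    unfolding u_def by (intro tendsto_divide_0[OF tendsto_const] filterlim_at_top_imp_at_infinity fst_F)
  have s_bdd: "(\<lambda>p. f (snd p)) \<in> O[F](\<lambda>_. 1)" if "continuous_on {-R..R} f" for f :: "real \<Rightarrow> real"
    unfolding F_def by (rule bigo_one_of_continuous_snd[OF that compact_Icc])
  have su_bigo: "(\<lambda>p. snd p * u p) \<in> O[F](u)"
    using landau_o.big.mult[OF s_bdd[of "\<lambda>s. s"], of u u] by simp
  have u_small: "u \<in> o[F](\<lambda>_. 1)"
    using u_lim by (intro smalloI_tendsto) auto
  have su_lim: "filterlim (\<lambda>p. snd p * u p) (nhds 0) F"
    using landau_o.big_small_trans[OF su_bigo u_small] by (auto dest: smalloD_tendsto)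
  have A_u: "(\<lambda>p. A n (u p)) \<in> O[F](\<lambda>p. u p ^ n)" for n
    unfolding A_def by (rule landau_o.big.compose[OF ln1p_remainder_bigo u_lim])
  have A_su: "(\<lambda>p. A n (snd p * u p)) \<in> O[F](\<lambda>p. u p ^ n)" for n
  proof -
    have "(\<lambda>p. A n (snd p * u p)) \<in> O[F](\<lambda>p. (snd p * u p) ^ n)"
      unfolding A_def by (rule landau_o.big.compose[OF ln1p_remainder_bigo su_lim])
    also have "(\<lambda>p. (snd p * u p) ^ n) \<in> O[F](\<lambda>p. u p ^ n)"
      by (rule landau_o.big_power[OF su_bigo])
    finally show ?thesis .
  qed
  have G_u: "(\<lambda>p. u p ^ (m + 1) * G m (u p)) \<in> O[F](\<lambda>p. u p ^ (M + 3))" if "m \<in> {1..M}" for m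
  proof -
    have "(\<lambda>p. G m (u p)) \<in> O[F](\<lambda>p. u p ^ (M + 2 - m))"
      unfolding G_def by (rule landau_o.big.compose[OF inverse_power_remainder_bigo u_lim])
    then have "(\<lambda>p. u p ^ (m + 1) * G m (u p)) \<in> O[F](\<lambda>p. u p ^ (m + 1) * u p ^ (M + 2 - m))"
      by (intro landau_o.big.mult) auto
    moreover have "m + 1 + (M + 2 - m) = M + 3" using that by auto
    ultimately show ?thesis by (simp only: flip: power_add)
  qed
  have "err \<in> O[F](\<lambda>p. u p ^ (M + 3))"
  proof -
    have u_Suc: "(\<lambda>p. u p * u p ^ (M + 2)) = (\<lambda>p. u p ^ (M + 3))"
      by (simp flip: power_Suc add: numeral_3_eq_3)
    have "(\<lambda>p. (snd p + 1/2) * (u p * A (M + 2) (u p))) \<in> O[F](\<lambda>p. 1 * (u p * u p ^ (M + 2)))"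
      by (intro landau_o.big.mult A_u s_bdd continuous_intros) auto
    then have t1: "(\<lambda>p. (snd p + 1/2) * (u p * A (M + 2) (u p))) \<in> O[F](\<lambda>p. u p ^ (M + 3))"
      by (simp only: u_Suc mult_1_left)
    have "(\<lambda>p. u p * A (M + 2) (snd p * u p)) \<in> O[F](\<lambda>p. u p * u p ^ (M + 2))"
      by (intro landau_o.big.mult A_su) auto
    then have t2: "(\<lambda>p. u p * A (M + 2) (snd p * u p)) \<in> O[F](\<lambda>p. u p ^ (M + 3))"
      by (simp only: u_Suc)
    have t3: "(\<lambda>p. stirling_coeff m (snd p) * (u p ^ (m + 1) * G m (u p))) \<in> O[F](\<lambda>p. u p ^ (M + 3))"
      if m: "m \<in> {1..M}" for m
    proof -
      have "(\<lambda>p. stirling_coeff m (snd p) * (u p ^ (m + 1) * G m (u p))) \<in> O[F](\<lambda>p. 1 * u p ^ (M + 3))"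
        unfolding stirling_coeff_def
        by (intro landau_o.big.mult G_u m s_bdd continuous_intros continuous_on_bernpoly)
           (use m in auto)
      then show ?thesis by (simp only: mult_1_left)
    qed
    show ?thesis
      unfolding err_def by (intro sum_in_bigo big_sum_in_bigo A_u t1 t2 t3)
  qed
  then obtain C where C: "eventually (\<lambda>p. norm (err p) \<le> C * norm (u p ^ (M + 3))) F"
    by (elim landau_o.bigE)
  obtain P Q where PQ: "eventually P at_top" "eventually Q (principal {-R..R})"
      "\<And>x s. P x \<Longrightarrow> Q s \<Longrightarrow> norm (err (x, s)) \<le> C * norm (u (x, s) ^ (M + 3))"
    using C unfolding F_def eventually_prod_filter by blast
  obtain X0 where X0: "\<And>x. x \<ge> X0 \<Longrightarrow> P x"
    using PQ(1) by (auto simp: eventually_at_top_linorder)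
  \<comment> \<open>The lower bound on x makes x + s positive, so that its logarithm can be split.\<close>
  have bound: "\<bar>D x s\<bar> \<le> C / x ^ (M + 2)" if x: "x \<ge> max X0 (\<bar>R\<bar> + 1)" and s: "\<bar>s\<bar> \<le> R" for x s
  proof -
    have pos: "x > 0" "x + s > 0" using x s by auto
    define v where "v = 1 / x"
    have "v > 0" and xv: "x = 1 / v" using pos by (auto simp: v_def)
    have ln_x1: "ln (x + 1) = ln x + ln (1 + v)" "ln (x + s) = ln x + ln (1 + s * v)"
    proof -
      have "x + 1 = x * (1 + v)" "x + s = x * (1 + s * v)"
        using pos by (auto simp: v_def field_simps)
      moreover from this have "1 + v > 0" "1 + s * v > 0"
        using pos \<open>v > 0\<close> by (auto simp: zero_less_mult_iff)
      ultimately show "ln (x + 1) = ln x + ln (1 + v)" "ln (x + s) = ln x + ln (1 + s * v)"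
        using pos by (simp_all add: ln_mult)
    qed
    have pow: "1 / (x + 1) ^ m = v ^ m * (1 / (1 + v) ^ m)" "1 / x ^ m = v ^ m" for m
    proof -
      have "1 / (x + 1) = v * (1 / (1 + v))"
        using pos by (simp add: v_def field_simps)
      then show "1 / (x + 1) ^ m = v ^ m * (1 / (1 + v) ^ m)"
        by (metis power_mult_distrib power_one_over)
      show "1 / x ^ m = v ^ m"
        by (simp add: v_def power_one_over)
    qed
    have "(\<Sum>m=1..M. stirling_coeff m s / (x + 1) ^ m) - (\<Sum>m=1..M. stirling_coeff m s / x ^ m)
        = (\<Sum>m=1..M. stirling_coeff m s * (1 / (x + 1) ^ m - 1 / x ^ m))"
      by (simp add: sum_subtractf[symmetric] right_diff_distrib)
    then have "v * D x s = v * ((x + s + 1/2) * ln (1 + v) - 1 - ln (1 + s * v)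
        + (\<Sum>m=1..M. stirling_coeff m s * (1 / (x + 1) ^ m - 1 / x ^ m)))"
      unfolding D_def stirling_sum_def stirling_leading_def ln_x1 by (simp add: algebra_simps)
    also have "\<dots> = v * ((x + s + 1/2) * ln (1 + v) - 1 - ln (1 + s * v)
        + (\<Sum>m=1..M. stirling_coeff m s * (v ^ m * (1 / (1 + v) ^ m - 1))))"
      by (simp only: pow right_diff_distrib mult_1_right)
    also have "\<dots> = ln (1 + v) + (s + 1/2) * v * ln (1 + v) - v - v * ln (1 + s * v)
        + (\<Sum>m=1..M. stirling_coeff m s * v ^ (m + 1) * (1 / (1 + v) ^ m - 1))"
      using \<open>v > 0\<close> by (simp add: xv sum_distrib_left algebra_simps)
    also have "\<dots> = err (x, s)"
    proof -
      have "(\<Sum>m=1..M. stirling_coeff m s * v ^ (m + 1) * (1 / (1 + v) ^ m - 1))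
          = (\<Sum>m=1..M. stirling_coeff m s * (v ^ (m + 1) * G m v))
            + (\<Sum>m=1..M. stirling_coeff m s * v ^ (m + 1) *
                ((\<Sum>j<M+2-m. ((- real m) gchoose j) * v ^ j) - 1))"
        unfolding sum.distrib[symmetric] G_def by (intro sum.cong) (auto simp: algebra_simps)
      moreover have "u (x, s) = v" by (simp add: u_def v_def)
      ultimately show ?thesis
        using stirling_truncation_vanishes[where M = M and u = v and s = s]
        unfolding err_def A_def by (simp add: algebra_simps)
    qed
    finally have "v * D x s = err (x, s)" .
    then have "\<bar>v * D x s\<bar> \<le> C * \<bar>v ^ (M + 3)\<bar>"
    proof -
      have "P x" "Q s"
        using X0[of x] PQ(2) x s by (auto simp: eventually_principal abs_le_iff)
      then show ?thesis
        using PQ(3)[of x s] \<open>v * D x s = err (x, s)\<close> by (simp add: u_def v_def)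
    qed
    also have "\<bar>v ^ (M + 3)\<bar> = v * (1 / x ^ (M + 2))"
      using \<open>v > 0\<close> unfolding pow by (simp add: numeral_3_eq_3)
    finally have "v * \<bar>D x s\<bar> \<le> v * (C / x ^ (M + 2))"
      using \<open>v > 0\<close> by (simp add: abs_mult mult_ac)
    then show ?thesis using \<open>v > 0\<close> by (rule mult_left_le_imp_le)
  qed
  show ?thesis
  proof (rule exI[of _ C], rule exI[of _ "max X0 (\<bar>R\<bar> + 1)"], intro allI impI)
    fix x s assume "max X0 (\<bar>R\<bar> + 1) \<le> x" "\<bar>s\<bar> \<le> R"
    from bound[OF this]
    show "\<bar>stirling_sum M (x + 1) s - stirling_sum M x s - ln (x + s)\<bar> \<le> C / x ^ (M + 2)"
      unfolding D_def .
  qed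
qed

section \<open>Stirling's formula along integer translates\<close>

text \<open>
  Consecutive terms differ by $O(n^{-2})$, so the telescoping series converges.
\<close>
lemma ln_fact_defect_convergent:
  "convergent (\<lambda>n. ln (fact n) - (real n + 1/2) * ln (real n) + real n)"
proof -
  define d where "d n = ln (fact n) - (real n + 1/2) * ln (real n) + real n" for n
  have "(\<lambda>n. 1 - (real n + 1/2) * (ln (real n + 1) - ln (real n))) \<in> O(\<lambda>n. 1 / real n ^ 2)"
    by real_asymp
  moreover have "eventually (\<lambda>n. 1 - (real n + 1/2) * (ln (real n + 1) - ln (real n)) = d (Suc n) - d n) sequentially"
    using eventually_gt_at_top[of "0::nat"]
  proof eventually_elim
    case (elim n)
    have "ln (fact (Suc n) :: real) = ln (real n + 1) + ln (fact n)"
      by (simp add: ln_mult algebra_simps flip: of_nat_Suc)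
    then show ?case by (simp add: d_def algebra_simps)
  qed
  ultimately have "(\<lambda>n. d (Suc n) - d n) \<in> O(\<lambda>n. 1 / real n ^ 2)"
    by (simp add: landau_o.big.in_cong)
  moreover have "summable (\<lambda>n. norm (1 / real n ^ 2))"
    using inverse_power_summable[of 2, where ?'a = real] by (simp add: field_simps)
  ultimately have "summable (\<lambda>n. d (Suc n) - d n)"
    by (rule summable_comparison_test_bigo[rotated])
  then have "convergent (\<lambda>n. d n - d 0)"
    by (simp add: summable_iff_convergent sum_lessThan_telescope)
  then have "convergent (\<lambda>n. (d n - d 0) + d 0)"
    by (intro convergent_add convergent_const)
  then show ?thesis by (simp add: d_def)
qed

lemma wallis_prod_eq_fact:
  "(\<Prod>k=1..n. 4 * real k ^ 2 / (4 * real k ^ 2 - 1))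
     = 16 ^ n * fact n ^ 4 / (fact (2 * n) ^ 2 * (2 * real n + 1))"
proof (induction n)
  case (Suc n)
  define u v w q :: real where "u = 2 * real n + 3" and "v = 2 * real n + 1"
    and "w = real n + 1" and "q = fact (2 * n)"
  have pos: "u > 0" "v > 0" "w > 0" "q > 0"
    by (auto simp: u_def v_def w_def q_def)
  have fact_even: "fact (2 * Suc n) = 2 * w * v * q"
    by (simp add: algebra_simps w_def v_def q_def)
  have fact_step: "fact (Suc n) = w * fact n"
    by (simp add: algebra_simps w_def)
  have "real (Suc n) = w" "4 * w ^ 2 - 1 = v * u" "2 * real (Suc n) + 1 = u"
    by (simp_all add: algebra_simps power2_eq_square u_def v_def w_def)
  then have "(\<Prod>k=1..Suc n. 4 * real k ^ 2 / (4 * real k ^ 2 - 1))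
      = 16 ^ n * fact n ^ 4 / (q ^ 2 * v) * (4 * w ^ 2 / (v * u))"
    using Suc.IH by (simp add: v_def q_def del: of_nat_Suc)
  also have "\<dots> = 16 ^ Suc n * (w * fact n) ^ 4 / ((2 * w * v * q) ^ 2 * u)"
    using pos by (simp add: divide_simps power2_eq_square power4_eq_xxxx)
  finally show ?case
    unfolding fact_even fact_step \<open>2 * real (Suc n) + 1 = u\<close> .
qed simp

text \<open>
  Wallis' product is a quotient of factorials. If the sequence has limit $L$, then inserting it into
  the logarithm of that quotient gives $4L - 2L - \ln 4$, while Wallis' formula gives $\ln(\pi/2)$.
\<close>
theorem stirling_ln_fact:
  "(\<lambda>n. ln (fact n) - (real n + 1/2) * ln (real n) + real n) \<longlonglongrightarrow> ln (2 * pi) / 2"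
proof -
  define d where "d n = ln (fact n) - (real n + 1/2) * ln (real n) + real n" for n
  obtain L where L: "d \<longlonglongrightarrow> L"
    using ln_fact_defect_convergent unfolding d_def convergent_def by blast
  have L2: "(\<lambda>n. d (2 * n)) \<longlonglongrightarrow> L"
    by (rule filterlim_compose[OF L]) real_asymp
  have "(\<lambda>n. ln (\<Prod>k=1..n. 4 * real k ^ 2 / (4 * real k ^ 2 - 1))) \<longlonglongrightarrow> ln (pi / 2)"
    by (intro tendsto_ln wallis) auto
  moreover have "eventually (\<lambda>n. ln (\<Prod>k=1..n. 4 * real k ^ 2 / (4 * real k ^ 2 - 1))
      = 4 * d n - 2 * d (2 * n) + (2 * ln (real n) - ln (2 * real n) - ln (2 * real n + 1))) sequentially"
    using eventually_gt_at_top[of "0::nat"]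
  proof eventually_elim
    case (elim n)
    have "ln (16::real) = 4 * ln 2"
      using ln_realpow[of "2::real" 4] by simp
    moreover have "ln (16 ^ n * fact n ^ 4 / (fact (2 * n) ^ 2 * (2 * real n + 1)))
        = real n * ln 16 + 4 * ln (fact n) - (2 * ln (fact (2 * n)) + ln (2 * real n + 1))"
      by (simp add: ln_div ln_mult ln_realpow add_pos_nonneg)
    moreover have "ln (2 * real n) = ln 2 + ln (real n)"
      using elim by (simp add: ln_mult)
    ultimately show ?case
      unfolding wallis_prod_eq_fact d_def by (simp add: algebra_simps)
  qed
  ultimately have "(\<lambda>n. 4 * d n - 2 * d (2 * n) + (2 * ln (real n) - ln (2 * real n) - ln (2 * real n + 1)))
      \<longlonglongrightarrow> ln (pi / 2)"
    by (rule Lim_transform_eventually)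
  moreover have "(\<lambda>n. 2 * ln (real n) - ln (2 * real n) - ln (2 * real n + 1)) \<longlonglongrightarrow> - ln 4"
    using ln_realpow[of "2::real" 2] by real_asymp
  then have "(\<lambda>n. 4 * d n - 2 * d (2 * n) + (2 * ln (real n) - ln (2 * real n) - ln (2 * real n + 1)))
      \<longlonglongrightarrow> 4 * L - 2 * L + - ln 4"
    by (intro tendsto_intros L L2)
  ultimately have "4 * L - 2 * L + - ln 4 = ln (pi / 2)"
    by (intro LIMSEQ_unique)
  moreover have "ln (2 * pi) = ln 4 + ln (pi / 2)"
    using ln_mult[of 4 "pi / 2"] by simp
  ultimately have "L = ln (2 * pi) / 2" by simp
  then show ?thesis using L unfolding d_def by blast
qed

lemma ln_Gamma_plus1_real:
  assumes "z > (0::real)"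
  shows "ln_Gamma (z + 1) = ln_Gamma z + ln z"
proof -
  have "Gamma (z + 1) = z * Gamma z"
    using assms by (intro Gamma_plus1) (auto simp: nonpos_Ints_def)
  moreover have "Gamma z > 0"
    using assms by (rule Gamma_real_pos)
  moreover have "ln_Gamma (z + 1) = ln (Gamma (z + 1))"
    using assms by (intro ln_Gamma_real_pos) simp
  ultimately show ?thesis
    using assms ln_Gamma_real_pos[OF assms] by (simp only: ln_mult_pos)
qed

text \<open>
  By the functional equation the sequence is \<^term>\<open>ln_Gamma z - ln_Gamma_series z n\<close>, and Euler's
  limit formula says that \<^term>\<open>ln_Gamma_series z\<close> tends to \<^term>\<open>ln_Gamma z\<close>.
\<close>
lemma ln_Gamma_shift_asymp:
  assumes "z > (0::real)"
  shows "(\<lambda>n. ln_Gamma (z + real n + 1) - z * ln (real n) - ln (fact n)) \<longlonglongrightarrow> 0"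
proof -
  have step: "ln_Gamma (z + real n + 1) = ln_Gamma (z + real n) + ln (z + real n)" for n
    using assms by (intro ln_Gamma_plus1_real add_pos_nonneg) auto
  have eq: "ln_Gamma (z + real n + 1) - z * ln (real n) - ln (fact n) = ln_Gamma z - ln_Gamma_series z n" for n
  proof (induction n)
    case 0
    then show ?case using step[of 0] by (simp add: ln_Gamma_series_def)
  next
    case (Suc n)
    have "ln (z / real (Suc n) + 1) = ln (z + real (Suc n)) - ln (real (Suc n))"
    proof -
      have "z / real (Suc n) + 1 = (z + real (Suc n)) / real (Suc n)"
        by (simp add: field_simps)
      then show ?thesis
        using assms by (simp add: ln_div add_pos_nonneg del: of_nat_Suc)
    qed
    moreover have "ln (fact (Suc n) :: real) = ln (real (Suc n)) + ln (fact n)"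
      by (simp add: ln_mult del: of_nat_Suc)
    ultimately show ?case using Suc.IH step[of "Suc n"]
      by (simp add: ln_Gamma_series_def algebra_simps)
  qed
  have "(\<lambda>n. ln_Gamma z - ln_Gamma_series z n) \<longlonglongrightarrow> ln_Gamma z - ln_Gamma z"
    by (intro tendsto_intros ln_Gamma_real_LIMSEQ assms)
  then show ?thesis by (simp add: eq)
qed

text \<open>
  For fixed \<^term>\<open>x\<close> and \<^term>\<open>s\<close> the correction terms vanish in the limit, so Stirling's formula for
  the factorials, moved to real arguments by \<open>ln_Gamma_shift_asymp\<close>, suffices. The
  index is shifted by one so that the argument is $z + n + 1$ with $z = x + s$.
\<close>
lemma stirling_sum_limit:
  assumes x: "x > 0" and xs: "x + s > 0"
  shows "(\<lambda>n. ln_Gamma (x + real n + s) - stirling_sum M (x + real n) s) \<longlonglongrightarrow> 0"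
proof (rule LIMSEQ_imp_Suc)
  have sum_lim: "(\<lambda>n. \<Sum>m=1..M. stirling_coeff m s / (x + 1 + real n) ^ m) \<longlonglongrightarrow> (\<Sum>m=1..M. 0)"
  proof (rule tendsto_sum)
    fix m assume "m \<in> {1..M}"
    then have "m > 0" by simp
    then show "(\<lambda>n. stirling_coeff m s / (x + 1 + real n) ^ m) \<longlonglongrightarrow> 0"
      by (intro tendsto_divide_0[OF tendsto_const] filterlim_at_top_imp_at_infinity
            filterlim_pow_at_top filterlim_tendsto_add_at_top[OF tendsto_const]
            filterlim_real_sequentially)
  qed
  have defect_lim: "(\<lambda>n. (real n + (x + s) + 1/2) * (ln (real n + x + 1) - ln (real n)) - (x + 1)) \<longlonglongrightarrow> 0"
    by real_asymp
  have "(\<lambda>n. (ln_Gamma (x + s + real n + 1) - (x + s) * ln (real n) - ln (fact n))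
     + (ln (fact n) - (real n + 1/2) * ln (real n) + real n - ln (2 * pi) / 2)
     - ((real n + (x + s) + 1/2) * (ln (real n + x + 1) - ln (real n)) - (x + 1))
     - (\<Sum>m=1..M. stirling_coeff m s / (x + 1 + real n) ^ m))
     \<longlonglongrightarrow> 0 + (ln (2 * pi) / 2 - ln (2 * pi) / 2) - 0 - (\<Sum>m=1..M. 0)"
    by (rule tendsto_diff[OF tendsto_diff[OF tendsto_add[OF ln_Gamma_shift_asymp[OF xs]
          tendsto_diff[OF stirling_ln_fact tendsto_const]] defect_lim] sum_lim])
  then show "(\<lambda>n. ln_Gamma (x + real (Suc n) + s) - stirling_sum M (x + real (Suc n)) s) \<longlonglongrightarrow> 0"
    by (simp add: stirling_sum_def stirling_leading_def algebra_simps)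
qed

section \<open>The uniform Stirling expansion\<close>

text \<open>
  Since $y^{-p} - (y+1)^{-p} \ge y^{-p}(1 - y/(y+1)) \ge \frac12 y^{-p-1}$ for $y \ge 1$, the increments are
  dominated by those of $-2C y^{-p}$. Summing to infinity loses only a factor $2$.
\<close>
lemma telescoped_tail_bound:
  fixes E :: "real \<Rightarrow> real"
  assumes lim: "(\<lambda>n. E (x + real n)) \<longlonglongrightarrow> 0" and x: "x \<ge> 1" and p: "p \<ge> 1" and C: "C \<ge> 0"
    and step: "\<And>y. y \<ge> x \<Longrightarrow> \<bar>E (y + 1) - E y\<bar> \<le> C / y ^ (p + 1)"
  shows "\<bar>E x\<bar> \<le> 2 * C / x ^ p"
proof -
  have dom: "C / y ^ (p + 1) \<le> 2 * C / y ^ p - 2 * C / (y + 1) ^ p" if "y \<ge> x" for y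
  proof -
    have y: "y \<ge> 1" using that x by simp
    have "(y / (y + 1)) ^ p \<le> y / (y + 1)"
      using y p power_decreasing[of 1 p "y / (y + 1)"] by simp
    also have "\<dots> = 1 - 1 / (y + 1)"
      using y by (simp add: field_simps)
    also have "\<dots> \<le> 1 - 1 / (2 * y)"
      using y by (simp add: field_simps)
    finally have "2 * C / y ^ p * (1 / (2 * y)) \<le> 2 * C / y ^ p * (1 - (y / (y + 1)) ^ p)"
      using C y by (intro mult_left_mono) auto
    then show ?thesis
      using y by (simp add: right_diff_distrib power_divide mult_ac)
  qed
  have "\<bar>E x\<bar> \<le> \<bar>E (x + real n)\<bar> + (2 * C / x ^ p - 2 * C / (x + real n) ^ p)" for n
  proof (induction n)
    case (Suc n)
    have "\<bar>E (x + real n + 1) - E (x + real n)\<bar> \<le> C / (x + real n) ^ (p + 1)"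
      by (rule step) simp
    moreover note dom[of "x + real n"] Suc.IH
    ultimately show ?case by (simp add: add_ac)
  qed simp
  then have "\<bar>E x\<bar> \<le> \<bar>E (x + real n)\<bar> + 2 * C / x ^ p" for n
    using C x by (smt (verit) of_nat_0_le_iff divide_nonneg_nonneg zero_le_power)
  moreover have "(\<lambda>n. \<bar>E (x + real n)\<bar> + 2 * C / x ^ p) \<longlonglongrightarrow> \<bar>0\<bar> + 2 * C / x ^ p"
    by (intro tendsto_intros lim)
  ultimately show ?thesis
    using LIMSEQ_le_const by fastforce
qed

text \<open>
  The error $E(x) = \ln\Gamma(x+s) - S_M(x,s)$ satisfies $E(x+1) - E(x) = O(x^{-M-2})$, because
  $\ln\Gamma(y+1) - \ln\Gamma(y) = \ln y$, and $E(x+n) \to 0$; summing the increments gives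
  $E(x) = O(x^{-M-1})$. All constants depend only on \<^term>\<open>M\<close> and the bound \<^term>\<open>R\<close> for \<^term>\<open>s\<close>.
\<close>
theorem ln_Gamma_stirling_uniform:
  "\<exists>C X0. 0 \<le> C \<and> 0 < X0 \<and> (\<forall>x\<ge>X0. \<forall>s. \<bar>s\<bar> \<le> R \<longrightarrow>
     \<bar>ln_Gamma (x + s) - stirling_sum M x s\<bar> \<le> C / x ^ (M + 1))"
proof -
  obtain C X where CX: "\<And>x s. x \<ge> X \<Longrightarrow> \<bar>s\<bar> \<le> R \<Longrightarrow>
     \<bar>stirling_sum M (x + 1) s - stirling_sum M x s - ln (x + s)\<bar> \<le> C / x ^ (M + 2)"
    using stirling_sum_increment[of R M] by metis
  define X0 where "X0 = max X (\<bar>R\<bar> + 1)"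
  have bound: "\<bar>ln_Gamma (x + s) - stirling_sum M x s\<bar> \<le> 2 * \<bar>C\<bar> / x ^ (M + 1)"
    if x: "x \<ge> X0" and s: "\<bar>s\<bar> \<le> R" for x s
  proof (rule telescoped_tail_bound)
    show "(\<lambda>n. ln_Gamma (x + real n + s) - stirling_sum M (x + real n) s) \<longlonglongrightarrow> 0"
      using x s by (intro stirling_sum_limit) (auto simp: X0_def)
    fix y assume y: "y \<ge> x"
    have pos: "y > 0" "y + s > 0" using x s y by (auto simp: X0_def)
    have "ln_Gamma (y + 1 + s) = ln_Gamma (y + s) + ln (y + s)"
      using ln_Gamma_plus1_real[of "y + s"] pos by (simp add: add_ac)
    moreover have "C / y ^ (M + 2) \<le> \<bar>C\<bar> / y ^ (M + 2)"
      using pos by (intro divide_right_mono) auto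
    moreover have "\<bar>stirling_sum M (y + 1) s - stirling_sum M y s - ln (y + s)\<bar> \<le> C / y ^ (M + 2)"
      using x y s by (intro CX) (auto simp: X0_def)
    moreover have exponent: "M + 1 + 1 = M + 2" by simp
    ultimately show "\<bar>(ln_Gamma (y + 1 + s) - stirling_sum M (y + 1) s)
        - (ln_Gamma (y + s) - stirling_sum M y s)\<bar> \<le> \<bar>C\<bar> / y ^ (M + 1 + 1)"
      unfolding exponent by linarith
  qed (use x in \<open>auto simp: X0_def\<close>)
  show ?thesis
  proof (rule exI[of _ "2 * \<bar>C\<bar>"], rule exI[of _ X0], intro conjI allI impI)
    show "0 \<le> 2 * \<bar>C\<bar>" by simp
    show "0 < X0" by (auto simp: X0_def)
  qed (rule bound)
qed

section \<open>The hypergeometric mass function\<close>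

lemma hyp_mass_conv_fact:
  fixes N K n k :: nat
  assumes "k \<le> K" "k \<le> n" "K \<le> N" "n \<le> N" "n - k \<le> N - K"
  shows "hyp_mass N K n (int k) =
     fact K * fact (N - K) * fact n * fact (N - n)
     / (fact N * (fact k * fact (K - k) * fact (n - k) * fact (N - K - (n - k))))"
  using assms by (simp add: hyp_mass_def binomial_fact divide_simps)

lemma ln_hyp_mass:
  fixes N K n k :: nat
  assumes "k \<le> K" "k \<le> n" "K \<le> N" "n \<le> N" "n - k \<le> N - K"
  shows "hyp_mass N K n (int k) > 0"
    and "ln (hyp_mass N K n (int k)) =
     ln_Gamma (real K + 1) + ln_Gamma (real N - real K + 1) + ln_Gamma (real n + 1) + ln_Gamma (real N - real n + 1)
     - ln_Gamma (real N + 1) - ln_Gamma (real k + 1) - ln_Gamma (real K - real k + 1)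
     - ln_Gamma (real n - real k + 1) - ln_Gamma (real N - real K - (real n - real k) + 1)"
proof -
  have ln_fact: "ln_Gamma (real m + 1) = ln (fact m)" for m
    using ln_Gamma_real_conv_fact[of "Suc m"] by (simp add: add.commute)
  note mass = hyp_mass_conv_fact[OF assms]
  show "hyp_mass N K n (int k) > 0"
    unfolding mass by (intro divide_pos_pos mult_pos_pos) auto
  have "ln (hyp_mass N K n (int k)) =
     ln_Gamma (real K + 1) + ln_Gamma (real (N - K) + 1) + ln_Gamma (real n + 1) + ln_Gamma (real (N - n) + 1)
     - ln_Gamma (real N + 1) - ln_Gamma (real k + 1) - ln_Gamma (real (K - k) + 1)
     - ln_Gamma (real (n - k) + 1) - ln_Gamma (real (N - K - (n - k)) + 1)"
    unfolding mass ln_fact by (simp add: ln_div ln_mult)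
  then show "ln (hyp_mass N K n (int k)) =
     ln_Gamma (real K + 1) + ln_Gamma (real N - real K + 1) + ln_Gamma (real n + 1) + ln_Gamma (real N - real n + 1)
     - ln_Gamma (real N + 1) - ln_Gamma (real k + 1) - ln_Gamma (real K - real k + 1)
     - ln_Gamma (real n - real k + 1) - ln_Gamma (real N - real K - (real n - real k) + 1)"
    using assms by (simp only: of_nat_diff)
qed

text \<open>
  The linear terms and the entropy terms cancel because $\kappa = a+b$, $\eta = a+c$ and
  $a+b+c+d = 1$; the terms with \<^term>\<open>t\<close> cancel because $ad = bc$. What remains is $-\frac12\ln(2\pi Nad)$,
  which is minus the logarithm of the normalising factor.
\<close>
lemma hyp_main_terms_cancel:
  fixes N \<kappa> \<eta> t :: real
  assumes "N > 0" "0 < \<kappa>" "\<kappa> < 1" "0 < \<eta>" "\<eta> < 1"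
  defines "a \<equiv> \<kappa> * \<eta>" and "b \<equiv> \<kappa> * (1 - \<eta>)" and "c \<equiv> \<eta> * (1 - \<kappa>)" and "d \<equiv> (1 - \<kappa>) * (1 - \<eta>)"
  shows "stirling_leading (N * \<kappa>) 1 + stirling_leading (N * (1 - \<kappa>)) 1 + stirling_leading (N * \<eta>) 1
     + stirling_leading (N * (1 - \<eta>)) 1 - stirling_leading N 1
     - stirling_leading (N * a) (t + 1) - stirling_leading (N * b) (1 - t)
     - stirling_leading (N * c) (1 - t) - stirling_leading (N * d) (t + 1)
     = - (ln (2 * pi) + ln N + ln \<kappa> + ln (1 - \<kappa>) + ln \<eta> + ln (1 - \<eta>)) / 2"
proof -
  define \<kappa>' \<eta>' where "\<kappa>' = 1 - \<kappa>" and "\<eta>' = 1 - \<eta>"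
  have pos: "\<kappa>' > 0" "\<eta>' > 0" using assms by (auto simp: \<kappa>'_def \<eta>'_def)
  define lN lk lk' le le' where l_defs: "lN = ln N" "lk = ln \<kappa>" "lk' = ln \<kappa>'" "le = ln \<eta>" "le' = ln \<eta>'"
  have lns: "ln (N * \<kappa>) = lN + lk" "ln (N * \<kappa>') = lN + lk'" "ln (N * \<eta>) = lN + le" "ln (N * \<eta>') = lN + le'"
    "ln (N * (\<kappa> * \<eta>)) = lN + lk + le" "ln (N * (\<kappa> * \<eta>')) = lN + lk + le'"
    "ln (N * (\<eta> * \<kappa>')) = lN + le + lk'" "ln (N * (\<kappa>' * \<eta>')) = lN + lk' + le'"
    using assms(1-5) pos by (simp_all add: ln_mult l_defs)
  show ?thesis
    unfolding stirling_leading_def a_def b_def c_def d_def \<kappa>'_def[symmetric] \<eta>'_def[symmetric] lns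
      l_defs[symmetric]
    unfolding \<kappa>'_def \<eta>'_def by (simp add: field_simps)
qed

lemma Sigma0_sq_conv:
  assumes "0 < K" "K < N" "0 < n" "n < N"
  defines "\<kappa> \<equiv> real K / real N" and "\<eta> \<equiv> real n / real N"
  shows "Sigma0_sq N K n = real N * (\<kappa> * (1 - \<kappa>) * \<eta> * (1 - \<eta>))"
proof -
  have N: "real N > 0" using assms by simp
  have "real K = real N * \<kappa>" "real n = real N * \<eta>"
    using N by (simp_all add: \<kappa>_def \<eta>_def)
  then have "Sigma0_sq N K n
      = real N * \<eta> * (real N * \<kappa>) * (real N - real N * \<kappa>) * (real N - real N * \<eta>) / real N ^ 3"
    using Sigma0_sq_altdef[OF assms(1-4)] by simp
  also have "\<dots> = real N * (\<kappa> * (1 - \<kappa>) * \<eta> * (1 - \<eta>))"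
    using N by (simp add: field_simps power3_eq_cube)
  finally show ?thesis .
qed

text \<open>
  The four margins and the total are expanded with shift $1$, the four cells with shift $t+1$ or
  $1-t$. Since $m + 1 \ge 2$, the value of the Bernoulli polynomial at $1$ is the Bernoulli number.
\<close>
lemma hyp_coeff_conv_stirling_coeff:
  fixes \<kappa> \<eta> t x :: real
  assumes "m \<ge> 1"
  defines "a \<equiv> \<kappa> * \<eta>" and "b \<equiv> \<kappa> * (1 - \<eta>)" and "c \<equiv> \<eta> * (1 - \<kappa>)" and "d \<equiv> (1 - \<kappa>) * (1 - \<eta>)"
  shows "hyp_coeff \<kappa> \<eta> m t / x ^ m =
     stirling_coeff m 1 / (x * \<kappa>) ^ m + stirling_coeff m 1 / (x * (1 - \<kappa>)) ^ m
     + stirling_coeff m 1 / (x * \<eta>) ^ m + stirling_coeff m 1 / (x * (1 - \<eta>)) ^ m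
     - stirling_coeff m 1 / x ^ m
     - stirling_coeff m (t + 1) / (x * a) ^ m - stirling_coeff m (1 - t) / (x * b) ^ m
     - stirling_coeff m (1 - t) / (x * c) ^ m - stirling_coeff m (t + 1) / (x * d) ^ m"
proof -
  define q where "q = (-1) ^ (m + 1) / (real m * real (m + 1))"
  have st: "stirling_coeff m s = q * bernpoly (m + 1) s" for s
    by (simp add: stirling_coeff_def q_def)
  have B1: "bernpoly (m + 1) 1 = bernoulli_number (m + 1)"
    using assms(1) by (intro bernpoly_1_eq_bernoulli_number) simp
  have div: "y / (x * z) ^ m = y * (1 / z ^ m) / x ^ m" for y z
    by (simp add: power_mult_distrib mult.commute)
  show ?thesis
    unfolding hyp_coeff_def Let_def q_def[symmetric] a_def[symmetric] b_def[symmetric]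
      c_def[symmetric] d_def[symmetric] st B1 div
    by (simp only: diff_divide_distrib[symmetric] add_divide_distrib[symmetric])
       (simp add: algebra_simps)
qed

lemma compact_subset_open_unit_square:
  assumes "compact J" and "J \<subseteq> {0<..<1} \<times> {0<..<(1::real)}"
  obtains \<delta> where "0 < \<delta>" "\<delta> \<le> 1"
    "\<And>\<kappa> \<eta>. (\<kappa>, \<eta>) \<in> J \<Longrightarrow> \<delta> \<le> \<kappa> \<and> \<delta> \<le> 1 - \<kappa> \<and> \<delta> \<le> \<eta> \<and> \<delta> \<le> 1 - (\<eta>::real)"
proof -
  define f where "f p = min (min (fst p) (1 - fst p)) (min (snd p) (1 - snd p))" for p :: "real \<times> real"
  show ?thesis
  proof (cases "J = {}")
    case True
    then show ?thesis by (intro that[of 1]) auto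
  next
    case False
    have "continuous_on J f" unfolding f_def by (intro continuous_intros)
    then obtain p where p: "p \<in> J" "\<And>q. q \<in> J \<Longrightarrow> f p \<le> f q"
      using continuous_attains_inf[OF assms(1) False] by metis
    show ?thesis
    proof (rule that[of "f p"])
      show "0 < f p" "f p \<le> 1" using p(1) assms(2) by (auto simp: f_def)
      fix \<kappa> \<eta> assume "(\<kappa>, \<eta>) \<in> J"
      from p(2)[OF this] show "f p \<le> \<kappa> \<and> f p \<le> 1 - \<kappa> \<and> f p \<le> \<eta> \<and> f p \<le> 1 - \<eta>"
        by (simp add: f_def)
    qed
  qed
qed

theorem theorem5p1:
  fixes J :: "(real \<times> real) set" and H :: "real set"
  assumes "compact J" and "J \<subseteq> {0<..<1} \<times> {0<..<1}" and "compact H"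
  shows "\<forall>M::nat. \<exists>(C::real) (N0::nat). \<forall>(N::nat) (K::nat) (n::nat) (t::real) (k::int).
           N \<ge> N0 \<longrightarrow> 0 < K \<longrightarrow> K < N \<longrightarrow> 0 < n \<longrightarrow> n < N \<longrightarrow>
           (real K / real N, real n / real N) \<in> J \<longrightarrow> t \<in> H \<longrightarrow>
           hyp_mean N K n + t = real_of_int k \<longrightarrow>
             hyp_mass N K n k > 0 \<and>
             \<bar>ln (sqrt (2 * pi * Sigma0_sq N K n) * hyp_mass N K n k)
               - (\<Sum>m=1..M. hyp_coeff (real K / real N) (real n / real N) m t / real N ^ m)\<bar>
             \<le> C / real N ^ (M + 1)"
proof
  fix M :: nat
  obtain \<delta> where \<delta>: "0 < \<delta>" "\<delta> \<le> 1"
    "\<And>\<kappa> \<eta>. (\<kappa>, \<eta>) \<in> J \<Longrightarrow> \<delta> \<le> \<kappa> \<and> \<delta> \<le> 1 - \<kappa> \<and> \<delta> \<le> \<eta> \<and> \<delta> \<le> 1 - \<eta>"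
    using compact_subset_open_unit_square[OF assms(1,2)] by metis
  obtain R where R: "R > 0" "\<And>t. t \<in> H \<Longrightarrow> \<bar>t\<bar> \<le> R"
    using compact_imp_bounded[OF assms(3)] by (auto simp: bounded_pos)
  obtain C X0 where C: "0 \<le> C" "0 < X0"
    and stirling: "\<And>x s. x \<ge> X0 \<Longrightarrow> \<bar>s\<bar> \<le> R + 1 \<Longrightarrow>
       \<bar>ln_Gamma (x + s) - stirling_sum M x s\<bar> \<le> C / x ^ (M + 1)"
    using ln_Gamma_stirling_uniform[of "R + 1" M] by metis
  \<comment> \<open>Cell proportions are products of two margin proportions, each at least \<delta>.\<close>
  define \<epsilon> where "\<epsilon> = \<delta> ^ 2"
  have \<epsilon>: "0 < \<epsilon>" using \<delta> by (simp add: \<epsilon>_def)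
  \<comment> \<open>Cells must be at least X0 for the Stirling expansion, and R for the counts to be nonnegative.\<close>
  obtain N0 :: nat where N0: "real N0 \<ge> max X0 R / \<epsilon>"
    using real_arch_simple by blast
  define C' where "C' = C / \<epsilon> ^ (M + 1)"
  show "\<exists>(C::real) (N0::nat). \<forall>(N::nat) (K::nat) (n::nat) (t::real) (k::int).
           N \<ge> N0 \<longrightarrow> 0 < K \<longrightarrow> K < N \<longrightarrow> 0 < n \<longrightarrow> n < N \<longrightarrow>
           (real K / real N, real n / real N) \<in> J \<longrightarrow> t \<in> H \<longrightarrow>
           hyp_mean N K n + t = real_of_int k \<longrightarrow>
             hyp_mass N K n k > 0 \<and>
             \<bar>ln (sqrt (2 * pi * Sigma0_sq N K n) * hyp_mass N K n k)
               - (\<Sum>m=1..M. hyp_coeff (real K / real N) (real n / real N) m t / real N ^ m)\<bar>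
             \<le> C / real N ^ (M + 1)"
  \<comment> \<open>There are nine Gamma factors: four margins, the total and four cells.\<close>
  proof (rule exI[of _ "9 * C'"], rule exI[of _ N0], intro allI impI)
    fix N K n :: nat and t :: real and k :: int
    assume NN0: "N \<ge> N0" and K: "0 < K" "K < N" and n: "0 < n" "n < N"
      and inJ: "(real K / real N, real n / real N) \<in> J" and tH: "t \<in> H"
      and mean: "hyp_mean N K n + t = real_of_int k"
    define \<kappa> \<eta> where "\<kappa> = real K / real N" and "\<eta> = real n / real N"
    define a b c d where "a = \<kappa> * \<eta>" and "b = \<kappa> * (1 - \<eta>)"
      and "c = \<eta> * (1 - \<kappa>)" and "d = (1 - \<kappa>) * (1 - \<eta>)"
    have N: "real N > 0" using K by simp
    have \<kappa>: "\<delta> \<le> \<kappa>" "\<delta> \<le> 1 - \<kappa>" and \<eta>: "\<delta> \<le> \<eta>" "\<delta> \<le> 1 - \<eta>"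
      using \<delta>(3)[OF inJ] by (auto simp: \<kappa>_def \<eta>_def)
    have t: "\<bar>t\<bar> \<le> R" using R(2)[OF tH] .
    have \<epsilon>_le: "\<epsilon> \<le> \<kappa>" "\<epsilon> \<le> 1 - \<kappa>" "\<epsilon> \<le> \<eta>" "\<epsilon> \<le> 1 - \<eta>" "\<epsilon> \<le> 1"
    proof -
      have "\<epsilon> \<le> \<delta>"
        using \<delta>(1,2) by (simp add: \<epsilon>_def power2_eq_square)
      then show "\<epsilon> \<le> \<kappa>" "\<epsilon> \<le> 1 - \<kappa>" "\<epsilon> \<le> \<eta>" "\<epsilon> \<le> 1 - \<eta>" "\<epsilon> \<le> 1"
        using \<delta>(2) \<kappa> \<eta> by linarith+
    qed
    have \<epsilon>_le_cells: "\<epsilon> \<le> a" "\<epsilon> \<le> b" "\<epsilon> \<le> c" "\<epsilon> \<le> d"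
      unfolding \<epsilon>_def power2_eq_square a_def b_def c_def d_def
      using \<delta>(1) \<kappa> \<eta> by (auto intro!: mult_mono)
    have N\<epsilon>: "real N * \<epsilon> \<ge> X0" "real N * \<epsilon> \<ge> R"
    proof -
      have "max X0 R / \<epsilon> \<le> real N" using N0 NN0 by linarith
      then have "max X0 R \<le> real N * \<epsilon>" using \<epsilon> by (simp add: field_simps)
      then show "real N * \<epsilon> \<ge> X0" "real N * \<epsilon> \<ge> R" by auto
    qed
    have cell: "R \<le> real N * y" if "\<epsilon> \<le> y" for y
      using N\<epsilon>(2) mult_left_mono[OF that, of "real N"] by simp
    have approx: "\<bar>ln_Gamma (real N * y + s) - stirling_sum M (real N * y) s\<bar> \<le> C' / real N ^ (M + 1)"
      if y: "\<epsilon> \<le> y" and s: "\<bar>s\<bar> \<le> R + 1" for y s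
    proof -
      have Ny: "real N * \<epsilon> \<le> real N * y" using y by (simp add: mult_left_mono)
      have "\<bar>ln_Gamma (real N * y + s) - stirling_sum M (real N * y) s\<bar> \<le> C / (real N * y) ^ (M + 1)"
        using Ny N\<epsilon>(1) s by (intro stirling) auto
      also have "\<dots> \<le> C / (real N * \<epsilon>) ^ (M + 1)"
        using C(1) Ny N \<epsilon> by (intro divide_left_mono power_mono mult_pos_pos zero_less_power) auto
      also have "\<dots> = C' / real N ^ (M + 1)"
        by (simp add: C'_def power_mult_distrib mult_ac)
      finally show ?thesis .
    qed
    have K_eq: "real K = real N * \<kappa>" and n_eq: "real n = real N * \<eta>"
      using N by (simp_all add: \<kappa>_def \<eta>_def)
    have k_eq: "real_of_int k = real N * a + t"
      using mean N by (simp add: hyp_mean_def a_def \<kappa>_def \<eta>_def mult.commute)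
    have counts: "real K - real_of_int k = real N * b - t" "real n - real_of_int k = real N * c - t"
      "real N - real K - (real n - real_of_int k) = real N * d + t"
      by (simp_all add: K_eq n_eq k_eq a_def b_def c_def d_def algebra_simps)
    have "real_of_int k \<ge> 0"
      using cell[OF \<epsilon>_le_cells(1)] t by (simp add: k_eq)
    then have "k \<ge> 0" by simp
    then obtain j :: nat where j: "k = int j" by (metis nonneg_int_cases)
    have le: "j \<le> K" "j \<le> n" "n + K \<le> N + j"
    proof -
      have "real j \<le> real K" "real j \<le> real n" "real n + real K \<le> real N + real j"
        using counts cell[OF \<epsilon>_le_cells(2)] cell[OF \<epsilon>_le_cells(3)] cell[OF \<epsilon>_le_cells(4)] t
        by (auto simp: j)
      then show "j \<le> K" "j \<le> n" "n + K \<le> N + j" by linarith+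
    qed
    have mass: "hyp_mass N K n k > 0"
      "ln (hyp_mass N K n k) =
         ln_Gamma (real N * \<kappa> + 1) + ln_Gamma (real N * (1 - \<kappa>) + 1)
         + ln_Gamma (real N * \<eta> + 1) + ln_Gamma (real N * (1 - \<eta>) + 1)
         - ln_Gamma (real N * 1 + 1)
         - ln_Gamma (real N * a + (t + 1)) - ln_Gamma (real N * b + (1 - t))
         - ln_Gamma (real N * c + (1 - t)) - ln_Gamma (real N * d + (t + 1))"
    proof -
      note m = ln_hyp_mass[of j K n N]
      show "hyp_mass N K n k > 0"
        unfolding j using le K n by (intro m(1)) auto
      have args: "real K + 1 = real N * \<kappa> + 1" "real N - real K + 1 = real N * (1 - \<kappa>) + 1"
        "real n + 1 = real N * \<eta> + 1" "real N - real n + 1 = real N * (1 - \<eta>) + 1"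
        "real N + 1 = real N * 1 + 1" "real j + 1 = real N * a + (t + 1)"
        "real K - real j + 1 = real N * b + (1 - t)" "real n - real j + 1 = real N * c + (1 - t)"
        "real N - real K - (real n - real j) + 1 = real N * d + (t + 1)"
        using k_eq counts by (simp_all add: j K_eq n_eq algebra_simps)
      have "ln (hyp_mass N K n (int j)) =
         ln_Gamma (real K + 1) + ln_Gamma (real N - real K + 1) + ln_Gamma (real n + 1) + ln_Gamma (real N - real n + 1)
         - ln_Gamma (real N + 1) - ln_Gamma (real j + 1) - ln_Gamma (real K - real j + 1)
         - ln_Gamma (real n - real j + 1) - ln_Gamma (real N - real K - (real n - real j) + 1)"
        using le K n by (intro m(2)) auto
      then show "ln (hyp_mass N K n k) =
         ln_Gamma (real N * \<kappa> + 1) + ln_Gamma (real N * (1 - \<kappa>) + 1)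
         + ln_Gamma (real N * \<eta> + 1) + ln_Gamma (real N * (1 - \<eta>) + 1)
         - ln_Gamma (real N * 1 + 1)
         - ln_Gamma (real N * a + (t + 1)) - ln_Gamma (real N * b + (1 - t))
         - ln_Gamma (real N * c + (1 - t)) - ln_Gamma (real N * d + (t + 1))"
        unfolding args j .
    qed
    have pos: "0 < \<kappa>" "0 < 1 - \<kappa>" "0 < \<eta>" "0 < 1 - \<eta>"
      using \<kappa> \<eta> \<delta>(1) by auto
    have "ln (sqrt (2 * pi * Sigma0_sq N K n))
        = (ln (2 * pi) + ln (real N) + ln \<kappa> + ln (1 - \<kappa>) + ln \<eta> + ln (1 - \<eta>)) / 2"
      using pos N pi_gt_zero unfolding Sigma0_sq_conv[OF K n] \<kappa>_def[symmetric] \<eta>_def[symmetric]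
      by (simp add: ln_sqrt ln_mult)
    moreover have "2 * pi * Sigma0_sq N K n > 0"
      using pos N unfolding Sigma0_sq_conv[OF K n] \<kappa>_def[symmetric] \<eta>_def[symmetric] by simp
    ultimately have ln_total: "ln (sqrt (2 * pi * Sigma0_sq N K n) * hyp_mass N K n k)
        = (ln (2 * pi) + ln (real N) + ln \<kappa> + ln (1 - \<kappa>) + ln \<eta> + ln (1 - \<eta>)) / 2
          + ln (hyp_mass N K n k)"
      using mass(1) by (simp add: ln_mult_pos)
    have coeffs: "(\<Sum>m=1..M. hyp_coeff \<kappa> \<eta> m t / real N ^ m) =
        (\<Sum>m=1..M. stirling_coeff m 1 / (real N * \<kappa>) ^ m)
        + (\<Sum>m=1..M. stirling_coeff m 1 / (real N * (1 - \<kappa>)) ^ m)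
        + (\<Sum>m=1..M. stirling_coeff m 1 / (real N * \<eta>) ^ m)
        + (\<Sum>m=1..M. stirling_coeff m 1 / (real N * (1 - \<eta>)) ^ m)
        - (\<Sum>m=1..M. stirling_coeff m 1 / (real N * 1) ^ m)
        - (\<Sum>m=1..M. stirling_coeff m (t + 1) / (real N * a) ^ m)
        - (\<Sum>m=1..M. stirling_coeff m (1 - t) / (real N * b) ^ m)
        - (\<Sum>m=1..M. stirling_coeff m (1 - t) / (real N * c) ^ m)
        - (\<Sum>m=1..M. stirling_coeff m (t + 1) / (real N * d) ^ m)"
      unfolding sum.distrib[symmetric] sum_subtractf[symmetric]
      by (intro sum.cong refl) (simp add: hyp_coeff_conv_stirling_coeff a_def b_def c_def d_def)
    have total: "(ln (2 * pi) + ln (real N) + ln \<kappa> + ln (1 - \<kappa>) + ln \<eta> + ln (1 - \<eta>)) / 2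
        + (stirling_sum M (real N * \<kappa>) 1 + stirling_sum M (real N * (1 - \<kappa>)) 1
           + stirling_sum M (real N * \<eta>) 1 + stirling_sum M (real N * (1 - \<eta>)) 1
           - stirling_sum M (real N * 1) 1
           - stirling_sum M (real N * a) (t + 1) - stirling_sum M (real N * b) (1 - t)
           - stirling_sum M (real N * c) (1 - t) - stirling_sum M (real N * d) (t + 1))
        = (\<Sum>m=1..M. hyp_coeff \<kappa> \<eta> m t / real N ^ m)"
    proof -
      have "\<kappa> < 1" "\<eta> < 1" using pos by simp_all
      note hyp_main_terms_cancel[OF N pos(1) this(1) pos(3) this(2), of t]
      then show ?thesis
        unfolding coeffs stirling_sum_def a_def b_def c_def d_def mult_1_right by linarith
    qed
    have shifts: "\<bar>1\<bar> \<le> R + 1" "\<bar>t + 1\<bar> \<le> R + 1" "\<bar>1 - t\<bar> \<le> R + 1"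
      using t R(1) by auto
    note errors = approx[OF \<epsilon>_le(1) shifts(1)] approx[OF \<epsilon>_le(2) shifts(1)]
      approx[OF \<epsilon>_le(3) shifts(1)] approx[OF \<epsilon>_le(4) shifts(1)] approx[OF \<epsilon>_le(5) shifts(1)]
      approx[OF \<epsilon>_le_cells(1) shifts(2)] approx[OF \<epsilon>_le_cells(2) shifts(3)]
      approx[OF \<epsilon>_le_cells(3) shifts(3)] approx[OF \<epsilon>_le_cells(4) shifts(2)]
    have "\<bar>ln (sqrt (2 * pi * Sigma0_sq N K n) * hyp_mass N K n k)
               - (\<Sum>m=1..M. hyp_coeff \<kappa> \<eta> m t / real N ^ m)\<bar>
             \<le> 9 * (C' / real N ^ (M + 1))"
      unfolding ln_total mass(2) total[symmetric]
      using errors[THEN abs_le_D1] errors[THEN abs_le_D2] by (intro abs_leI) linarith+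
    then show "hyp_mass N K n k > 0 \<and>
             \<bar>ln (sqrt (2 * pi * Sigma0_sq N K n) * hyp_mass N K n k)
               - (\<Sum>m=1..M. hyp_coeff (real K / real N) (real n / real N) m t / real N ^ m)\<bar>
             \<le> 9 * C' / real N ^ (M + 1)"
      using mass(1) by (simp add: \<kappa>_def \<eta>_def)
  qed
qed

end
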